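(* Let $\Omega\subset\mathbf{C}$ be a domain and let $X:\Omega\to\mathbf{R}^3$ be a regular harmonic surface with Gauss map $\mathbf{n}=\frac{X_x\times X_y}{\|X_x\times X_y\|}:\Omega\to S^2$. Then $\mathbf{n}$ is regular if and only if the surface $X$ is not planar. Moreover, if $\mathbf{n}$ is not regular, then $\mathbf{n}$ is a constant vector.
   Context: A domain is a connected open set; $z=x+iy$, subscripts $x,y$ denote partial derivatives, $\times$ is the cross product and $\|\cdot\|$ the Euclidean norm in $\mathbf{R}^3$. A harmonic surface is a map $X=(a,b,c):\Omega\to\mathbf{R}^3$ whose coordinate functions are harmonic in $(x,y)$; it is regular (an immersion) if $X_x\times X_y\neq0$ at every point. The surface is planar if $X(\Omega)$ is contained in an affine plane of $\mathbf{R}^3$. The Gauss map $\mathbf{n}$ is called regular if $\mathbf{n}_x\times\mathbf{n}_y$ is not identically zero on some nonempty open subset of $\Omega$ (equivalently, since $\mathbf{n}$ is real analytic and $\Omega$ is connected, not identically zero on $\Omega$). *)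

theory Defs
  imports "HOL-Analysis.Analysis"
begin

unbundle cross3_syntax

definition partial_x :: "(complex \<Rightarrow> 'a::real_normed_vector) \<Rightarrow> complex \<Rightarrow> 'a" where
  "partial_x f z = vector_derivative (\<lambda>t. f (Complex t (Im z))) (at (Re z))"

definition partial_y :: "(complex \<Rightarrow> 'a::real_normed_vector) \<Rightarrow> complex \<Rightarrow> 'a" where
  "partial_y f z = vector_derivative (\<lambda>t. f (Complex (Re z) t)) (at (Im z))"

(* Meaningful for open D: the differentiability conditions are needed because
   vector_derivative is an arbitrary value where no derivative exists. *)
definition C1_on :: "(complex \<Rightarrow> 'a::real_normed_vector) \<Rightarrow> complex set \<Rightarrow> bool" where
  "C1_on f D \<longleftrightarrow>
     (\<forall>z\<in>D. (\<lambda>t. f (Complex t (Im z))) differentiable (at (Re z)) \<and>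
            (\<lambda>t. f (Complex (Re z) t)) differentiable (at (Im z))) \<and>
     continuous_on D (partial_x f) \<and> continuous_on D (partial_y f)"

definition C2_on :: "(complex \<Rightarrow> 'a::real_normed_vector) \<Rightarrow> complex set \<Rightarrow> bool" where
  "C2_on f D \<longleftrightarrow> C1_on f D \<and> C1_on (partial_x f) D \<and> C1_on (partial_y f) D"

definition harmonic_fun_on :: "(complex \<Rightarrow> real) \<Rightarrow> complex set \<Rightarrow> bool" where
  "harmonic_fun_on f D \<longleftrightarrow>
     C2_on f D \<and> (\<forall>z\<in>D. partial_x (partial_x f) z + partial_y (partial_y f) z = 0)"

definition harmonic_surface_on :: "(complex \<Rightarrow> real^3) \<Rightarrow> complex set \<Rightarrow> bool" where
  "harmonic_surface_on X D \<longleftrightarrow> (\<forall>i. harmonic_fun_on (\<lambda>z. X z $ i) D)"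

definition regular_surface_on :: "(complex \<Rightarrow> real^3) \<Rightarrow> complex set \<Rightarrow> bool" where
  "regular_surface_on X D \<longleftrightarrow> (\<forall>z\<in>D. partial_x X z \<times> partial_y X z \<noteq> 0)"

definition gauss_map :: "(complex \<Rightarrow> real^3) \<Rightarrow> complex \<Rightarrow> real^3" where
  "gauss_map X z =
     (partial_x X z \<times> partial_y X z) /\<^sub>R norm (partial_x X z \<times> partial_y X z)"

(* This is weaker than regular_surface_on: the cross product may vanish at some points. *)
definition regular_gauss_map_on :: "(complex \<Rightarrow> real^3) \<Rightarrow> complex set \<Rightarrow> bool" where
  "regular_gauss_map_on n D \<longleftrightarrow>
     (\<exists>U. open U \<and> U \<noteq> {} \<and> U \<subseteq> D \<and> \<not> (\<forall>z\<in>U. partial_x n z \<times> partial_y n z = 0))"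

definition planar_on :: "(complex \<Rightarrow> real^3) \<Rightarrow> complex set \<Rightarrow> bool" where
  "planar_on X D \<longleftrightarrow> (\<exists>P. affine P \<and> aff_dim P = 2 \<and> X ` D \<subseteq> P)"

end

theory Submission
  imports Defs
begin

text \<open>
  Let \<open>h\<^sub>1\<^sub>1, h\<^sub>1\<^sub>2, h\<^sub>2\<^sub>2\<close> be the inner products of \<open>n\<close> with \<open>X\<^sub>x\<^sub>x, X\<^sub>x\<^sub>y, X\<^sub>y\<^sub>y\<close>.
  Differentiating the orthogonality of \<open>n\<close> to \<open>X\<^sub>x\<close> and \<open>X\<^sub>y\<close> shows that the inner products of
  \<open>n\<^sub>x, n\<^sub>y\<close> with \<open>X\<^sub>x, X\<^sub>y\<close> are the \<open>-h\<^sub>i\<^sub>j\<close>, and harmonicity gives \<open>h\<^sub>2\<^sub>2 = -h\<^sub>1\<^sub>1\<close>. By the Binet--Cauchy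
  identity the inner product of \<open>n\<^sub>x \<times> n\<^sub>y\<close> with \<open>X\<^sub>x \<times> X\<^sub>y\<close> is therefore
  \<open>-(h\<^sub>1\<^sub>1\<^sup>2 + h\<^sub>1\<^sub>2\<^sup>2)\<close>. So if \<open>n\<^sub>x \<times> n\<^sub>y\<close> vanishes at a point, all \<open>h\<^sub>i\<^sub>j\<close> vanish there, and with them
  \<open>n\<^sub>x\<close> and \<open>n\<^sub>y\<close>. No analyticity is needed: a non-regular \<open>n\<close> has zero partial derivatives on the
  whole domain.
\<close>

subsection \<open>Partial derivatives\<close>

lemma C1_on_has_partial_x:
  assumes "C1_on f D" "z \<in> D"
  shows "((\<lambda>t. f (Complex t (Im z))) has_vector_derivative partial_x f z) (at (Re z))"
  using assms unfolding C1_on_def partial_x_def by (simp add: vector_derivative_works)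

lemma C1_on_has_partial_y:
  assumes "C1_on f D" "z \<in> D"
  shows "((\<lambda>t. f (Complex (Re z) t)) has_vector_derivative partial_y f z) (at (Im z))"
  using assms unfolding C1_on_def partial_y_def by (simp add: vector_derivative_works)

lemma eventually_horizontal:
  assumes "open D" "z \<in> D"
  shows "\<forall>\<^sub>F t in nhds (Re z). Complex t (Im z) \<in> D"
proof -
  have "((\<lambda>t. Complex t (Im z)) \<longlongrightarrow> Complex (Re z) (Im z)) (nhds (Re z))"
    by (intro tendsto_Complex tendsto_const filterlim_ident)
  with assms show ?thesis by (simp add: topological_tendstoD)
qed

lemma eventually_vertical:
  assumes "open D" "z \<in> D"
  shows "\<forall>\<^sub>F t in nhds (Im z). Complex (Re z) t \<in> D"
proof -
  have "((\<lambda>t. Complex (Re z) t) \<longlongrightarrow> Complex (Re z) (Im z)) (nhds (Im z))"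
    by (intro tendsto_Complex tendsto_const filterlim_ident)
  with assms show ?thesis by (simp add: topological_tendstoD)
qed

lemma has_vector_derivative_cong_nhds:
  assumes "(f has_vector_derivative f') (at x)" "\<forall>\<^sub>F t in nhds x. f t = g t"
  shows "(g has_vector_derivative f') (at x)"
proof -
  have "\<forall>\<^sub>F t in at x. f t = g t"
    using assms(2) by (simp add: eventually_nhds_conv_at)
  moreover have "f x = g x"
    using assms(2) by (rule eventually_nhds_x_imp_x)
  ultimately show ?thesis
    using assms(1) has_derivative_transform_eventually
    unfolding has_vector_derivative_def by blast
qed

text \<open>Since \<open>D\<close> is open, agreement on \<open>D\<close> becomes agreement near
  each of its points along both axes, and this determines the partial derivatives.\<close>

lemma C1_on_cong:
  assumes "open D" and "\<And>z. z \<in> D \<Longrightarrow> f z = g z" and "C1_on f D"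
  shows "C1_on g D"
    and "\<And>z. z \<in> D \<Longrightarrow> partial_x g z = partial_x f z"
    and "\<And>z. z \<in> D \<Longrightarrow> partial_y g z = partial_y f z"
proof -
  have dx: "((\<lambda>t. g (Complex t (Im z))) has_vector_derivative partial_x f z) (at (Re z))"
    if "z \<in> D" for z
    using C1_on_has_partial_x[OF assms(3) that]
  proof (rule has_vector_derivative_cong_nhds)
    show "\<forall>\<^sub>F t in nhds (Re z). f (Complex t (Im z)) = g (Complex t (Im z))"
      using eventually_horizontal[OF assms(1) that] by eventually_elim (rule assms(2))
  qed
  have dy: "((\<lambda>t. g (Complex (Re z) t)) has_vector_derivative partial_y f z) (at (Im z))"
    if "z \<in> D" for z
    using C1_on_has_partial_y[OF assms(3) that]
  proof (rule has_vector_derivative_cong_nhds)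
    show "\<forall>\<^sub>F t in nhds (Im z). f (Complex (Re z) t) = g (Complex (Re z) t)"
      using eventually_vertical[OF assms(1) that] by eventually_elim (rule assms(2))
  qed
  show px: "partial_x g z = partial_x f z" if "z \<in> D" for z
    using vector_derivative_at[OF dx[OF that]] by (simp add: partial_x_def)
  show py: "partial_y g z = partial_y f z" if "z \<in> D" for z
    using vector_derivative_at[OF dy[OF that]] by (simp add: partial_y_def)
  have "continuous_on D (partial_x g)" "continuous_on D (partial_y g)"
    using assms(3) by (auto simp: C1_on_def px py cong: continuous_on_cong)
  then show "C1_on g D"
    using dx dy by (auto simp: C1_on_def intro: differentiableI_vector)
qed

section \<open>From coordinate functions to vector-valued maps\<close>

lemma has_vector_derivative_vecI:
  fixes f :: "real \<Rightarrow> real ^ 'n"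
  assumes "\<And>i. ((\<lambda>t. f t $ i) has_vector_derivative f' $ i) (at x)"
  shows "(f has_vector_derivative f') (at x)"
proof -
  have "((\<lambda>t. f t \<bullet> b) has_derivative (\<lambda>h. (h *\<^sub>R f') \<bullet> b)) (at x)" if b: "b \<in> Basis" for b
  proof -
    obtain i where "b = axis i 1"
      using b by (auto simp: Basis_vec_def)
    then show ?thesis
      using assms[of i] by (simp add: has_vector_derivative_def inner_axis)
  qed
  then show ?thesis
    by (auto simp: has_vector_derivative_def has_derivative_componentwise_within[of f])
qed

text \<open>Harmonicity is given coordinate by coordinate, whereas cross products require
  derivatives of the whole vector; this lemma and \<open>C2_on_vec\<close> bridge the two.\<close>

lemma C1_on_vec:
  fixes f :: "complex \<Rightarrow> real ^ 'n"
  assumes "\<And>i. C1_on (\<lambda>z. f z $ i) D"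
  shows "C1_on f D"
    and "\<And>z i. z \<in> D \<Longrightarrow> partial_x f z $ i = partial_x (\<lambda>z. f z $ i) z"
    and "\<And>z i. z \<in> D \<Longrightarrow> partial_y f z $ i = partial_y (\<lambda>z. f z $ i) z"
proof -
  have dx: "((\<lambda>t. f (Complex t (Im z))) has_vector_derivative
      (\<chi> i. partial_x (\<lambda>z. f z $ i) z)) (at (Re z))" if "z \<in> D" for z
    by (rule has_vector_derivative_vecI) (simp add: C1_on_has_partial_x[OF assms that])
  have dy: "((\<lambda>t. f (Complex (Re z) t)) has_vector_derivative
      (\<chi> i. partial_y (\<lambda>z. f z $ i) z)) (at (Im z))" if "z \<in> D" for z
    by (rule has_vector_derivative_vecI) (simp add: C1_on_has_partial_y[OF assms that])
  have px: "partial_x f z = (\<chi> i. partial_x (\<lambda>z. f z $ i) z)" if "z \<in> D" for z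
    using vector_derivative_at[OF dx[OF that]] by (simp add: partial_x_def)
  have py: "partial_y f z = (\<chi> i. partial_y (\<lambda>z. f z $ i) z)" if "z \<in> D" for z
    using vector_derivative_at[OF dy[OF that]] by (simp add: partial_y_def)
  show "partial_x f z $ i = partial_x (\<lambda>z. f z $ i) z" if "z \<in> D" for z i
    using px[OF that] by simp
  show "partial_y f z $ i = partial_y (\<lambda>z. f z $ i) z" if "z \<in> D" for z i
    using py[OF that] by simp
  have "continuous_on D (\<lambda>z. \<chi> i. partial_x (\<lambda>z. f z $ i) z)"
       "continuous_on D (\<lambda>z. \<chi> i. partial_y (\<lambda>z. f z $ i) z)"
    using assms by (auto simp: C1_on_def intro!: continuous_on_vec_lambda)
  then have "continuous_on D (partial_x f)" "continuous_on D (partial_y f)"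
    by (simp_all add: px py cong: continuous_on_cong)
  then show "C1_on f D"
    using dx dy by (auto simp: C1_on_def intro: differentiableI_vector)
qed

lemma C2_on_vec:
  fixes f :: "complex \<Rightarrow> real ^ 'n"
  assumes D: "open D" and f: "\<And>i. C2_on (\<lambda>z. f z $ i) D"
  shows "C2_on f D"
    and "\<And>z i. z \<in> D \<Longrightarrow> partial_x (partial_x f) z $ i = partial_x (partial_x (\<lambda>z. f z $ i)) z"
    and "\<And>z i. z \<in> D \<Longrightarrow> partial_y (partial_x f) z $ i = partial_y (partial_x (\<lambda>z. f z $ i)) z"
    and "\<And>z i. z \<in> D \<Longrightarrow> partial_x (partial_y f) z $ i = partial_x (partial_y (\<lambda>z. f z $ i)) z"
    and "\<And>z i. z \<in> D \<Longrightarrow> partial_y (partial_y f) z $ i = partial_y (partial_y (\<lambda>z. f z $ i)) z"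
proof -
  have f1: "C1_on (\<lambda>z. f z $ i) D" and fx: "C1_on (partial_x (\<lambda>z. f z $ i)) D"
    and fy: "C1_on (partial_y (\<lambda>z. f z $ i)) D" for i
    using f[of i] by (auto simp: C2_on_def)
  note v = C1_on_vec[of f D, OF f1]
  \<comment> \<open>The coordinates of \<open>partial_x f\<close> are known to be the
    \<open>partial_x\<close> of the coordinates only on \<open>D\<close>, so smoothness and second
    partials are carried across by \<open>C1_on_cong\<close>.\<close>
  note cx = C1_on_cong[OF D v(2)[symmetric] fx]
  note cy = C1_on_cong[OF D v(3)[symmetric] fy]
  note vx = C1_on_vec[of "partial_x f" D, OF cx(1)]
  note vy = C1_on_vec[of "partial_y f" D, OF cy(1)]
  show "C2_on f D"
    using v(1) vx(1) vy(1) by (simp add: C2_on_def)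
  show "partial_x (partial_x f) z $ i = partial_x (partial_x (\<lambda>z. f z $ i)) z" if "z \<in> D" for z i
    using vx(2) cx(2) that by simp
  show "partial_y (partial_x f) z $ i = partial_y (partial_x (\<lambda>z. f z $ i)) z" if "z \<in> D" for z i
    using vx(3) cx(3) that by simp
  show "partial_x (partial_y f) z $ i = partial_x (partial_y (\<lambda>z. f z $ i)) z" if "z \<in> D" for z i
    using vy(2) cy(2) that by simp
  show "partial_y (partial_y f) z $ i = partial_y (partial_y (\<lambda>z. f z $ i)) z" if "z \<in> D" for z i
    using vy(3) cy(3) that by simp
qed

section \<open>Symmetry of the mixed second partials\<close>

text \<open>Two applications of the mean value theorem: first in \<open>s\<close> to the difference
  of \<open>f\<close> between heights \<open>b+h\<close> and \<open>b\<close>, then in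
  \<open>t\<close> to \<open>fs s\<close>.\<close>

lemma second_difference_mvt:
  fixes f fs fst :: "real \<Rightarrow> real \<Rightarrow> real"
  assumes h: "h > 0"
    and fs: "\<And>s t. s \<in> {a..a+h} \<Longrightarrow> t \<in> {b..b+h} \<Longrightarrow> ((\<lambda>s. f s t) has_real_derivative fs s t) (at s)"
    and fst: "\<And>s t. s \<in> {a..a+h} \<Longrightarrow> t \<in> {b..b+h} \<Longrightarrow> (fs s has_real_derivative fst s t) (at t)"
  obtains s t where "s \<in> {a..a+h}" "t \<in> {b..b+h}"
    "f (a+h) (b+h) - f (a+h) b - f a (b+h) + f a b = h * h * fst s t"
proof -
  have "\<exists>s. a < s \<and> s < a + h \<and>
      (f (a+h) (b+h) - f (a+h) b) - (f a (b+h) - f a b) = (a + h - a) * (fs s (b+h) - fs s b)"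
    using h by (intro MVT2) (auto intro!: DERIV_diff fs)
  then obtain s where s: "a < s" "s < a + h"
    "(f (a+h) (b+h) - f (a+h) b) - (f a (b+h) - f a b) = h * (fs s (b+h) - fs s b)"
    by auto
  have "\<exists>t. b < t \<and> t < b + h \<and> fs s (b+h) - fs s b = (b + h - b) * fst s t"
    using h s by (intro MVT2) (auto intro!: fst)
  then obtain t where "b < t" "t < b + h" "fs s (b+h) - fs s b = h * fst s t"
    by auto
  with s that[of s t] show ?thesis by (simp add: algebra_simps)
qed

text \<open>The second difference of \<open>f\<close> over a small square with corner
  \<open>z\<close> is \<open>h * h\<close> times either mixed partial, each taken at some point of
  the square. Continuity at \<open>z\<close> then forces the two values at \<open>z\<close> to
  agree.\<close>

lemma mixed_partials_commute:
  fixes f :: "complex \<Rightarrow> real"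
  assumes D: "open D" and f: "C2_on f D" and z: "z \<in> D"
  shows "partial_x (partial_y f) z = partial_y (partial_x f) z"
proof -
  have c1: "C1_on f D" "C1_on (partial_x f) D" "C1_on (partial_y f) D"
    using f by (auto simp: C2_on_def)
  have cont: "isCont (partial_x (partial_y f)) z" "isCont (partial_y (partial_x f)) z"
    using c1 D z by (auto simp: C1_on_def continuous_on_eq_continuous_at)
  have "dist (partial_x (partial_y f) z) (partial_y (partial_x f) z) < e" if e: "e > 0" for e
  proof -
    have "\<forall>\<^sub>F w in nhds z. dist (partial_x (partial_y f) w) (partial_x (partial_y f) z) < e / 2"
         "\<forall>\<^sub>F w in nhds z. dist (partial_y (partial_x f) w) (partial_y (partial_x f) z) < e / 2"
      using cont e half_gt_zero[of e] tendstoD unfolding isCont_def tendsto_at_iff_tendsto_nhds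
      by blast+
    moreover have "\<forall>\<^sub>F w in nhds z. w \<in> D"
      using D z by (rule eventually_nhds_in_open)
    ultimately have "\<forall>\<^sub>F w in nhds z. w \<in> D
        \<and> dist (partial_x (partial_y f) w) (partial_x (partial_y f) z) < e / 2
        \<and> dist (partial_y (partial_x f) w) (partial_y (partial_x f) z) < e / 2"
      by eventually_elim auto
    then obtain d where d: "d > 0" and near: "\<And>w. dist w z < d \<Longrightarrow> w \<in> D
        \<and> dist (partial_x (partial_y f) w) (partial_x (partial_y f) z) < e / 2
        \<and> dist (partial_y (partial_x f) w) (partial_y (partial_x f) z) < e / 2"
      unfolding eventually_nhds_metric by blast
    \<comment> \<open>Points of the square lie within \<open>2 * h\<close> of \<open>z\<close>, and
      \<open>h = d / 3\<close> makes this less than \<open>d\<close>.\<close>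
    define h a b where "h = d / 3" and "a = Re z" and "b = Im z"
    have h: "h > 0" using d by (simp add: h_def)
    have dst: "dist (Complex s t) z < d" if "s \<in> {a..a+h}" "t \<in> {b..b+h}" for s t
    proof -
      have "dist (Complex s t) z \<le> \<bar>s - a\<bar> + \<bar>t - b\<bar>"
        using cmod_le[of "Complex s t - z"] by (simp add: dist_norm a_def b_def)
      then show ?thesis using that d by (simp add: h_def)
    qed
    note inD = near[OF dst, THEN conjunct1]
    obtain s t where st: "s \<in> {a..a+h}" "t \<in> {b..b+h}"
      "f (Complex (a+h) (b+h)) - f (Complex (a+h) b) - f (Complex a (b+h)) + f (Complex a b)
        = h * h * partial_y (partial_x f) (Complex s t)"
    proof (rule second_difference_mvt[OF h])
      fix s t assume *: "s \<in> {a..a+h}" "t \<in> {b..b+h}"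
      show "((\<lambda>s. f (Complex s t)) has_real_derivative partial_x f (Complex s t)) (at s)"
        using C1_on_has_partial_x[OF c1(1) inD[OF *]]
        by (simp add: has_real_derivative_iff_has_vector_derivative)
      show "((\<lambda>t. partial_x f (Complex s t)) has_real_derivative
          partial_y (partial_x f) (Complex s t)) (at t)"
        using C1_on_has_partial_y[OF c1(2) inD[OF *]]
        by (simp add: has_real_derivative_iff_has_vector_derivative)
    qed
    \<comment> \<open>The same square with the variables exchanged; this only swaps the two middle
      terms of the second difference.\<close>
    obtain t' s' where st': "t' \<in> {b..b+h}" "s' \<in> {a..a+h}"
      "f (Complex (a+h) (b+h)) - f (Complex a (b+h)) - f (Complex (a+h) b) + f (Complex a b)
        = h * h * partial_x (partial_y f) (Complex s' t')"
    proof (rule second_difference_mvt[OF h, where f = "\<lambda>t s. f (Complex s t)"])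
      fix t s assume *: "t \<in> {b..b+h}" "s \<in> {a..a+h}"
      show "((\<lambda>t. f (Complex s t)) has_real_derivative partial_y f (Complex s t)) (at t)"
        using C1_on_has_partial_y[OF c1(1) inD[OF *(2,1)]]
        by (simp add: has_real_derivative_iff_has_vector_derivative)
      show "((\<lambda>s. partial_y f (Complex s t)) has_real_derivative
          partial_x (partial_y f) (Complex s t)) (at s)"
        using C1_on_has_partial_x[OF c1(3) inD[OF *(2,1)]]
        by (simp add: has_real_derivative_iff_has_vector_derivative)
    qed
    have "h * h * partial_x (partial_y f) (Complex s' t')
        = h * h * partial_y (partial_x f) (Complex s t)"
      using st(3) st'(3) by linarith
    then have "partial_x (partial_y f) (Complex s' t') = partial_y (partial_x f) (Complex s t)"
      using h by simp
    \<comment> \<open>The common value is within \<open>e / 2\<close> of both mixed partials at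
      \<open>z\<close>.\<close>
    then show ?thesis
      using near[OF dst[OF st(1,2)]] near[OF dst[OF st'(2,1)]]
      unfolding dist_real_def by linarith
  qed
  then show ?thesis
    by (metis dist_pos_lt less_irrefl)
qed

section \<open>Constancy from vanishing partial derivatives\<close>

lemma zero_vector_derivative_segment:
  fixes f :: "real \<Rightarrow> 'a::real_normed_vector"
  assumes "\<And>t. t \<in> closed_segment a b \<Longrightarrow> (f has_vector_derivative 0) (at t)"
  shows "f a = f b"
proof -
  have "\<forall>t\<in>closed_segment a b. (f has_vector_derivative 0) (at t within closed_segment a b)"
    using assms by (simp add: has_vector_derivative_at_within)
  then obtain c where "\<And>t. t \<in> closed_segment a b \<Longrightarrow> f t = c"
    using has_vector_derivative_zero_constant[of "closed_segment a b" f] by auto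
  then show ?thesis
    by simp
qed

text \<open>Inside a ball around \<open>z\<close>, a point \<open>w\<close> is reached by a
  horizontal segment followed by a vertical one. No point of this path is farther from
  \<open>z\<close> than \<open>w\<close>, so \<open>f\<close> is constant on the ball; connectedness
  makes local constancy global.\<close>

lemma zero_partials_imp_constant_on:
  fixes f :: "complex \<Rightarrow> 'a::real_normed_vector"
  assumes D: "open D" "connected D"
    and x: "\<And>z. z \<in> D \<Longrightarrow> ((\<lambda>t. f (Complex t (Im z))) has_vector_derivative 0) (at (Re z))"
    and y: "\<And>z. z \<in> D \<Longrightarrow> ((\<lambda>t. f (Complex (Re z) t)) has_vector_derivative 0) (at (Im z))"
  shows "f constant_on D"
proof (rule locally_constant_imp_constant[OF D(2)])
  fix z assume "z \<in> D"
  then obtain r where r: "r > 0" "ball z r \<subseteq> D"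
    using D(1) openE by blast
  have "f w = f z" if w: "w \<in> ball z r" for w
  proof -
    have "Complex t (Im z) \<in> D" if "t \<in> closed_segment (Re z) (Re w)" for t
    proof -
      have "\<bar>t - Re z\<bar> \<le> \<bar>Re w - Re z\<bar>"
        using that by (auto simp: closed_segment_eq_real_ivl split: if_splits)
      also have "\<dots> \<le> dist z w"
        using abs_Re_le_cmod[of "z - w"] by (simp add: dist_norm abs_minus_commute)
      also have "\<bar>t - Re z\<bar> = dist z (Complex t (Im z))"
        by (simp add: dist_norm cmod_def abs_minus_commute)
      finally have "dist z (Complex t (Im z)) \<le> dist z w" .
      then show ?thesis using w r by auto
    qed
    from x[OF this] have 1: "f (Complex (Re z) (Im z)) = f (Complex (Re w) (Im z))"
      by (intro zero_vector_derivative_segment[of _ _ "\<lambda>t. f (Complex t (Im z))"]) simp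
    have "Complex (Re w) t \<in> D" if "t \<in> closed_segment (Im z) (Im w)" for t
    proof -
      have "\<bar>t - Im z\<bar> \<le> \<bar>Im w - Im z\<bar>"
        using that by (auto simp: closed_segment_eq_real_ivl split: if_splits)
      then have "(Im z - t)\<^sup>2 \<le> (Im z - Im w)\<^sup>2"
        by (simp add: abs_le_square_iff power2_commute)
      then have "dist z (Complex (Re w) t) \<le> dist z w"
        by (simp add: dist_complex_def cmod_def)
      then show ?thesis using w r by auto
    qed
    from y[OF this] have 2: "f (Complex (Re w) (Im z)) = f (Complex (Re w) (Im w))"
      by (intro zero_vector_derivative_segment[of _ _ "\<lambda>t. f (Complex (Re w) t)"]) simp
    show ?thesis using 1 2 by simp
  qed
  moreover have "openin (top_of_set D) (ball z r)"
    using r D(1) by (simp add: open_subset)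
  ultimately show "\<exists>T. openin (top_of_set D) T \<and> z \<in> T \<and> (\<forall>w\<in>T. f w = f z)"
    using r(1) centre_in_ball by blast
qed

subsection \<open>The Gauss map\<close>

lemma bounded_bilinear_cross3: "bounded_bilinear ((\<times>) :: real^3 \<Rightarrow> real^3 \<Rightarrow> real^3)"
  using bilinear_cross by (simp add: bilinear_conv_bounded_bilinear)

text \<open>The unit normal to a moving pair of vectors: the three identities come from
  differentiating \<open>n \<bullet> n\<close>, \<open>n \<bullet> A\<close> and
  \<open>n \<bullet> B\<close>.\<close>

lemma unit_normal_derivative:
  fixes A B :: "real \<Rightarrow> real^3"
  defines "n \<equiv> \<lambda>t. (A t \<times> B t) /\<^sub>R norm (A t \<times> B t)"
  assumes A: "(A has_vector_derivative A') (at t)" and B: "(B has_vector_derivative B') (at t)"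
    and nz: "A t \<times> B t \<noteq> 0"
  obtains n' where "(n has_vector_derivative n') (at t)" "n' \<bullet> n t = 0"
    "n' \<bullet> A t = - (n t \<bullet> A')" "n' \<bullet> B t = - (n t \<bullet> B')"
proof -
  have "(\<lambda>t. A t \<times> B t) differentiable at t"
    using bounded_bilinear.has_vector_derivative[OF bounded_bilinear_cross3 A B]
    by (rule differentiableI_vector)
  moreover from this have "(\<lambda>t. inverse (norm (A t \<times> B t))) differentiable at t"
    using nz differentiable_compose[of norm "\<lambda>t. A t \<times> B t" t UNIV] differentiable_norm_at
    by (intro differentiable_inverse) auto
  ultimately have "n differentiable at t"
    unfolding n_def by (rule differentiable_scaleR[rotated])
  then obtain n' where n': "(n has_vector_derivative n') (at t)"
    using vector_derivative_works by blast
  note inner = bounded_bilinear.has_vector_derivative[OF bounded_bilinear_inner]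
  have "((\<lambda>t. n t \<bullet> n t) has_real_derivative n t \<bullet> n' + n' \<bullet> n t) (at t)"
    using inner[OF n' n'] by (simp add: has_real_derivative_iff_has_vector_derivative)
  \<comment> \<open>\<open>n \<bullet> n\<close> is 1 only where the cross product is nonzero, and 0
    elsewhere. It is thus at most 1 everywhere with equality at \<open>t\<close>, so its derivative
    vanishes at a maximum.\<close>
  then have "n t \<bullet> n' + n' \<bullet> n t = 0"
  proof (rule DERIV_local_max[where d = 1])
    have "n s \<bullet> n s \<le> 1" for s
      by (cases "A s \<times> B s = 0") (simp_all add: n_def dot_square_norm)
    moreover have "n t \<bullet> n t = 1"
      using nz by (simp add: n_def dot_square_norm)
    ultimately show "\<forall>s. \<bar>t - s\<bar> < 1 \<longrightarrow> n s \<bullet> n s \<le> n t \<bullet> n t" by simp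
  qed simp
  moreover have "n t \<bullet> A' + n' \<bullet> A t = 0"
  proof -
    \<comment> \<open>This holds at every parameter, since \<open>n\<close> is 0 where the cross
      product vanishes.\<close>
    have "(\<lambda>t. n t \<bullet> A t) = (\<lambda>t. 0)"
      by (simp add: n_def dot_cross_self fun_eq_iff)
    with inner[OF n' A] show ?thesis
      using vector_derivative_unique_at[OF _ has_vector_derivative_const] by metis
  qed
  moreover have "n t \<bullet> B' + n' \<bullet> B t = 0"
  proof -
    have "(\<lambda>t. n t \<bullet> B t) = (\<lambda>t. 0)"
      by (simp add: n_def dot_cross_self fun_eq_iff)
    with inner[OF n' B] show ?thesis
      using vector_derivative_unique_at[OF _ has_vector_derivative_const] by metis
  qed
  ultimately show ?thesis
    using that[OF n'] by (simp add: inner_commute)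
qed

text \<open>By the triple product expansion, \<open>v\<close> has zero cross product with
  \<open>p \<times> q\<close> as well as zero inner product, and \<open>p \<times> q\<close> is
  nonzero.\<close>

lemma eq_0_if_orthogonal_frame:
  fixes v p q :: "real^3"
  assumes "v \<bullet> p = 0" "v \<bullet> q = 0" "v \<bullet> (p \<times> q) = 0" "p \<times> q \<noteq> 0"
  shows "v = 0"
proof -
  have "v \<times> (p \<times> q) = (v \<bullet> q) *\<^sub>R p - (v \<bullet> p) *\<^sub>R q"
    by (simp add: Lagrange)
  then show ?thesis
    using assms norm_and_cross_eq_0[of v "p \<times> q"] by auto
qed

section \<open>Weingarten equations and the second fundamental form\<close>

text \<open>The setting shared by both directions of the equivalence. Harmonicity and connectedness
  enter as hypotheses of the individual lemmas that use them.\<close>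

locale regular_C2_surface =
  fixes D :: "complex set" and X :: "complex \<Rightarrow> real^3"
  assumes D: "open D" and C2: "C2_on X D" and reg: "regular_surface_on X D"
begin

abbreviation "n \<equiv> gauss_map X"

lemma n_ne_0: "z \<in> D \<Longrightarrow> n z \<noteq> 0"
  using reg by (simp add: regular_surface_on_def gauss_map_def)

lemma C1: "C1_on X D" "C1_on (partial_x X) D" "C1_on (partial_y X) D"
  using C2 by (auto simp: C2_on_def)

text \<open>The Weingarten equations along a horizontal line, from
  \<open>unit_normal_derivative\<close> with \<open>A\<close> and \<open>B\<close> the two partials
  of \<open>X\<close>. The first claim ensures that \<open>partial_x n z\<close> is a genuine
  derivative.\<close>

lemma gauss_map_partial_x:
  assumes z: "z \<in> D"
  shows "((\<lambda>t. n (Complex t (Im z))) has_vector_derivative partial_x n z) (at (Re z))"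
    and "partial_x n z \<bullet> n z = 0"
    and "partial_x n z \<bullet> partial_x X z = - (n z \<bullet> partial_x (partial_x X) z)"
    and "partial_x n z \<bullet> partial_y X z = - (n z \<bullet> partial_x (partial_y X) z)"
proof -
  have "partial_x X (Complex (Re z) (Im z)) \<times> partial_y X (Complex (Re z) (Im z)) \<noteq> 0"
    using reg z by (simp add: regular_surface_on_def)
  from unit_normal_derivative[OF C1_on_has_partial_x[OF C1(2) z] C1_on_has_partial_x[OF C1(3) z] this]
  obtain n' where n': "((\<lambda>t. n (Complex t (Im z))) has_vector_derivative n') (at (Re z))"
    and *: "n' \<bullet> n z = 0" "n' \<bullet> partial_x X z = - (n z \<bullet> partial_x (partial_x X) z)"
      "n' \<bullet> partial_y X z = - (n z \<bullet> partial_x (partial_y X) z)"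
    by (auto simp: gauss_map_def)
  have "n' = partial_x n z"
    using vector_derivative_at[OF n'] by (simp add: partial_x_def)
  with n' * show "((\<lambda>t. n (Complex t (Im z))) has_vector_derivative partial_x n z) (at (Re z))"
    "partial_x n z \<bullet> n z = 0"
    "partial_x n z \<bullet> partial_x X z = - (n z \<bullet> partial_x (partial_x X) z)"
    "partial_x n z \<bullet> partial_y X z = - (n z \<bullet> partial_x (partial_y X) z)"
    by simp_all
qed

lemma gauss_map_partial_y:
  assumes z: "z \<in> D"
  shows "((\<lambda>t. n (Complex (Re z) t)) has_vector_derivative partial_y n z) (at (Im z))"
    and "partial_y n z \<bullet> n z = 0"
    and "partial_y n z \<bullet> partial_x X z = - (n z \<bullet> partial_y (partial_x X) z)"
    and "partial_y n z \<bullet> partial_y X z = - (n z \<bullet> partial_y (partial_y X) z)"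
proof -
  have "partial_x X (Complex (Re z) (Im z)) \<times> partial_y X (Complex (Re z) (Im z)) \<noteq> 0"
    using reg z by (simp add: regular_surface_on_def)
  from unit_normal_derivative[OF C1_on_has_partial_y[OF C1(2) z] C1_on_has_partial_y[OF C1(3) z] this]
  obtain n' where n': "((\<lambda>t. n (Complex (Re z) t)) has_vector_derivative n') (at (Im z))"
    and *: "n' \<bullet> n z = 0" "n' \<bullet> partial_x X z = - (n z \<bullet> partial_y (partial_x X) z)"
      "n' \<bullet> partial_y X z = - (n z \<bullet> partial_y (partial_y X) z)"
    by (auto simp: gauss_map_def)
  have "n' = partial_y n z"
    using vector_derivative_at[OF n'] by (simp add: partial_y_def)
  with n' * show "((\<lambda>t. n (Complex (Re z) t)) has_vector_derivative partial_y n z) (at (Im z))"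
    "partial_y n z \<bullet> n z = 0"
    "partial_y n z \<bullet> partial_x X z = - (n z \<bullet> partial_y (partial_x X) z)"
    "partial_y n z \<bullet> partial_y X z = - (n z \<bullet> partial_y (partial_y X) z)"
    by simp_all
qed

text \<open>Harmonicity makes the second fundamental form trace-free in these coordinates, so its
  determinant is minus a sum of squares and vanishes only if the whole form does.\<close>

lemma gauss_map_partials_eq_0:
  assumes z: "z \<in> D" and harm: "partial_x (partial_x X) z + partial_y (partial_y X) z = 0"
    and sym: "partial_x (partial_y X) z = partial_y (partial_x X) z"
    and flat: "partial_x n z \<times> partial_y n z = 0"
  shows "partial_x n z = 0" "partial_y n z = 0"
proof -
  note px = gauss_map_partial_x[OF z] and py = gauss_map_partial_y[OF z]
  define h11 h12 where "h11 = n z \<bullet> partial_x (partial_x X) z"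
    and "h12 = n z \<bullet> partial_y (partial_x X) z"
  have "partial_y (partial_y X) z = - partial_x (partial_x X) z"
    using harm by (simp add: eq_neg_iff_add_eq_0 add.commute)
  then have h22: "n z \<bullet> partial_y (partial_y X) z = - h11"
    by (simp add: h11_def)
  have "0 = (partial_x n z \<times> partial_y n z) \<bullet> (partial_x X z \<times> partial_y X z)"
    using flat by simp
  \<comment> \<open>\<open>dot_cross\<close> gives the determinant of the inner products of the
    partials of \<open>n\<close> with those of \<open>X\<close>; \<open>sym\<close> identifies its
    off-diagonal entries.\<close>
  also have "\<dots> = - (h11\<^sup>2 + h12\<^sup>2)"
    using px(3,4) py(3,4) sym h22
    by (simp add: dot_cross h11_def h12_def power2_eq_square)
  finally have "h11\<^sup>2 + h12\<^sup>2 = 0"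
    by linarith
  then have "h11 = 0" "h12 = 0"
    by (simp_all add: sum_power2_eq_zero_iff)
  then have tangential: "partial_x n z \<bullet> partial_x X z = 0" "partial_x n z \<bullet> partial_y X z = 0"
      "partial_y n z \<bullet> partial_x X z = 0" "partial_y n z \<bullet> partial_y X z = 0"
    using px py sym h22 by (simp_all add: h11_def h12_def)
  have nz: "partial_x X z \<times> partial_y X z \<noteq> 0"
    using reg z by (simp add: regular_surface_on_def)
  \<comment> \<open>\<open>n z\<close> is a nonzero multiple of the cross product, so orthogonality
    to \<open>n z\<close> transfers to it.\<close>
  then have "partial_x n z \<bullet> (partial_x X z \<times> partial_y X z) = 0"
      "partial_y n z \<bullet> (partial_x X z \<times> partial_y X z) = 0"
    using px(2) py(2) by (simp_all add: gauss_map_def)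
  then show "partial_x n z = 0" "partial_y n z = 0"
    using tangential nz eq_0_if_orthogonal_frame by blast+
qed

section \<open>Planarity and the Gauss map\<close>

text \<open>The height of \<open>X\<close> in the direction of the constant normal \<open>v\<close>
  has zero partial derivatives, so \<open>X\<close> stays in a plane orthogonal to
  \<open>v\<close>.\<close>

lemma constant_gauss_map_imp_planar:
  assumes conn: "connected D" and const: "n constant_on D"
  shows "planar_on X D"
proof -
  obtain v where v: "\<And>z. z \<in> D \<Longrightarrow> n z = v"
    using const by (auto simp: constant_on_def)
  have orth: "v \<bullet> partial_x X z = 0" "v \<bullet> partial_y X z = 0" if "z \<in> D" for z
    using v[OF that, symmetric] by (simp_all add: gauss_map_def dot_cross_self)
  have "(\<lambda>z. v \<bullet> X z) constant_on D"
  proof (rule zero_partials_imp_constant_on[OF D conn])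
    fix z assume z: "z \<in> D"
    note inner = bounded_linear.has_vector_derivative[OF bounded_linear_inner_right[of v]]
    show "((\<lambda>t. v \<bullet> X (Complex t (Im z))) has_vector_derivative 0) (at (Re z))"
      using inner[OF C1_on_has_partial_x[OF C1(1) z]] by (simp add: orth z)
    show "((\<lambda>t. v \<bullet> X (Complex (Re z) t)) has_vector_derivative 0) (at (Im z))"
      using inner[OF C1_on_has_partial_y[OF C1(1) z]] by (simp add: orth z)
  qed
  then obtain c where c: "\<And>z. z \<in> D \<Longrightarrow> v \<bullet> X z = c"
    by (auto simp: constant_on_def)
  \<comment> \<open>If \<open>D\<close> is empty then \<open>v\<close> may be \<open>0\<close>.\<close>
  obtain u b where u: "u \<noteq> (0::real^3)" "X ` D \<subseteq> {x. u \<bullet> x = b}"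
  proof (cases "D = {}")
    case True
    then show ?thesis using that[of "axis 1 1" 0] by (simp add: axis_eq_0_iff)
  next
    case False
    then have "v \<noteq> 0" using v n_ne_0 by blast
    moreover have "X ` D \<subseteq> {x. v \<bullet> x = c}" using c by blast
    ultimately show ?thesis by (rule that)
  qed
  have "aff_dim {x. u \<bullet> x = b} = 2"
    using aff_dim_hyperplane[OF u(1)] by simp
  then show ?thesis
    using u(2) affine_hyperplane[of u b]
    unfolding planar_on_def by (intro exI[of _ "{x. u \<bullet> x = b}"] conjI)
qed

lemma planar_imp_not_regular_gauss_map:
  assumes "planar_on X D"
  shows "\<not> regular_gauss_map_on n D"
proof -
  obtain P where P: "affine P" "aff_dim P = 2" "X ` D \<subseteq> P"
    using assms by (auto simp: planar_on_def)
  \<comment> \<open>In \<open>real^3\<close>, affine dimension 2 is codimension one, so the affine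
    plane \<open>P\<close> is a hyperplane.\<close>
  then have "\<exists>a b. a \<noteq> 0 \<and> affine hull P = {x. a \<bullet> x = b}"
    using aff_dim_eq_hyperplane[of P] by simp
  then obtain v b where v: "v \<noteq> 0" "P = {x. v \<bullet> x = b}"
    using P(1) affine_hull_eq by metis
  have X: "v \<bullet> X z = b" if "z \<in> D" for z
    using P(3) v(2) that by blast
  \<comment> \<open>Taking \<open>L\<close> to be the inner product with \<open>v\<close> and the cross product with \<open>v\<close> respectively, first
     \<open>v\<close> is orthogonal to the tangent plane, hence \<open>n\<close> and its partial derivatives are parallel
     to \<open>v\<close>.\<close>
  have constx: "L (partial_x f z) = 0"
    if L: "bounded_linear L" and z: "z \<in> D" and Lf: "\<And>w. w \<in> D \<Longrightarrow> L (f w) = c"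
      and f: "((\<lambda>t. f (Complex t (Im z))) has_vector_derivative partial_x f z) (at (Re z))"
    for L :: "real^3 \<Rightarrow> 'a::real_normed_vector" and f c z
  proof -
    have "((\<lambda>t. c) has_vector_derivative L (partial_x f z)) (at (Re z))"
      using bounded_linear.has_vector_derivative[OF L f]
    proof (rule has_vector_derivative_cong_nhds)
      show "\<forall>\<^sub>F t in nhds (Re z). L (f (Complex t (Im z))) = c"
        using eventually_horizontal[OF D z] by eventually_elim (rule Lf)
    qed
    then show ?thesis
      using vector_derivative_unique_at has_vector_derivative_const by blast
  qed
  have consty: "L (partial_y f z) = 0"
    if L: "bounded_linear L" and z: "z \<in> D" and Lf: "\<And>w. w \<in> D \<Longrightarrow> L (f w) = c"
      and f: "((\<lambda>t. f (Complex (Re z) t)) has_vector_derivative partial_y f z) (at (Im z))"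
    for L :: "real^3 \<Rightarrow> 'a::real_normed_vector" and f c z
  proof -
    have "((\<lambda>t. c) has_vector_derivative L (partial_y f z)) (at (Im z))"
      using bounded_linear.has_vector_derivative[OF L f]
    proof (rule has_vector_derivative_cong_nhds)
      show "\<forall>\<^sub>F t in nhds (Im z). L (f (Complex (Re z) t)) = c"
        using eventually_vertical[OF D z] by eventually_elim (rule Lf)
    qed
    then show ?thesis
      using vector_derivative_unique_at has_vector_derivative_const by blast
  qed
  have par: "v \<times> n z = 0" if z: "z \<in> D" for z
  proof -
    have "v \<bullet> partial_x X z = 0" "v \<bullet> partial_y X z = 0"
      using constx[OF bounded_linear_inner_right z X C1_on_has_partial_x[OF C1(1) z]]
        consty[OF bounded_linear_inner_right z X C1_on_has_partial_y[OF C1(1) z]] by auto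
    \<comment> \<open>\<open>Lagrange\<close> writes the cross product of \<open>v\<close> with the
      normal as a combination of the partials of \<open>X\<close>, with coefficients their inner
      products with \<open>v\<close>.\<close>
    then show ?thesis
      by (simp add: gauss_map_def cross_mult_right Lagrange)
  qed
  have "partial_x n z \<times> partial_y n z = 0" if z: "z \<in> D" for z
  proof -
    note cr = bounded_bilinear.bounded_linear_right[OF bounded_bilinear_cross3, of v]
    have "v \<times> partial_x n z = 0" "v \<times> partial_y n z = 0"
      using constx[OF cr z par gauss_map_partial_x(1)[OF z]]
        consty[OF cr z par gauss_map_partial_y(1)[OF z]] by auto
    \<comment> \<open>As \<open>v\<close> is nonzero, collinearity with \<open>v\<close> means being
      a multiple of \<open>v\<close>, the zero vector being the multiple by 0.\<close>
    then obtain c d where "partial_x n z = c *\<^sub>R v" "partial_y n z = d *\<^sub>R v"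
      using v(1) unfolding cross_eq_0 collinear_lemma by (metis scaleR_zero_left)
    then show ?thesis
      by (simp add: cross_mult_left cross_mult_right)
  qed
  then show ?thesis
    by (auto simp: regular_gauss_map_on_def)
qed

end

theorem theorem1p3:
  fixes \<Omega> :: "complex set" and X :: "complex \<Rightarrow> real^3"
  assumes "open \<Omega>" and "connected \<Omega>"
    and "harmonic_surface_on X \<Omega>"
    and "regular_surface_on X \<Omega>"
  shows "(regular_gauss_map_on (gauss_map X) \<Omega> \<longleftrightarrow> \<not> planar_on X \<Omega>) \<and>
         (\<not> regular_gauss_map_on (gauss_map X) \<Omega> \<longrightarrow> gauss_map X constant_on \<Omega>)"
proof -
  have C2i: "C2_on (\<lambda>z. X z $ i) \<Omega>" for i
    using assms(3) by (simp add: harmonic_surface_on_def harmonic_fun_on_def)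
  note XC2 = C2_on_vec[OF assms(1) C2i]
  interpret regular_C2_surface \<Omega> X
    using assms(1,4) XC2(1) by unfold_locales
  have const: "n constant_on \<Omega>" if nreg: "\<not> regular_gauss_map_on n \<Omega>"
  proof -
    have "partial_x n z = 0 \<and> partial_y n z = 0" if z: "z \<in> \<Omega>" for z
    proof -
      have "partial_x (partial_x X) z + partial_y (partial_y X) z = 0"
        using assms(3) XC2(2,5)[OF z]
        by (simp add: vec_eq_iff z harmonic_surface_on_def harmonic_fun_on_def)
      moreover have "partial_x (partial_y X) z = partial_y (partial_x X) z"
        using mixed_partials_commute[OF assms(1) C2i z] by (simp add: vec_eq_iff XC2(3,4) z)
      \<comment> \<open>Non-regularity is applied to the open set \<open>\<Omega>\<close> itself,
        which is nonempty as it contains \<open>z\<close>.\<close>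
      moreover have "partial_x n z \<times> partial_y n z = 0"
        using nreg assms(1) z unfolding regular_gauss_map_on_def by blast
      ultimately show ?thesis
        using gauss_map_partials_eq_0[OF z] by blast
    qed
    then show ?thesis
      using gauss_map_partial_x(1) gauss_map_partial_y(1)
      by (intro zero_partials_imp_constant_on[OF assms(1,2)]) metis+
  qed
  \<comment> \<open>A non-regular Gauss map is constant, a constant one makes \<open>X\<close>
    planar, and planarity gives non-regularity, which closes the cycle.\<close>
  then show ?thesis
    using planar_imp_not_regular_gauss_map constant_gauss_map_imp_planar[OF assms(2)] by blast
qed

end
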